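(* Let $\mathbb{E}$ be a (finite-dimensional) Euclidean space, let $f\in\Gamma_0(\mathbb{E})$ and $(\bar x,\bar\alpha)\in\mathbb{E}\times\mathbb{R}$. Then the following statements hold. (a) $\frac12d^2_{\mathrm{epi} f}(\bar x,\bar\alpha)=-\min_{\lambda\ge0}\{\bar\phi^f_{\bar x}(\lambda)+\bar\alpha\lambda+\frac12\lambda^2\}$. (b) $$P_{\mathrm{epi} f}(\bar x,\bar\alpha)=\begin{cases}(P_{\mathrm{cl}(\mathrm{dom} f)}(\bar x),\ \bar\alpha)&\text{if }f(P_{\mathrm{cl}(\mathrm{dom} f)}(\bar x))\le\bar\alpha,\\(P_{\bar\lambda}f(\bar x),\ \bar\alpha+\bar\lambda)&\text{otherwise},\end{cases}$$ where (in the second case) $\bar\lambda>0$ is the unique solution of the strongly convex optimization problem $$\min_{\lambda\ge0}\ \tfrac12\lambda^2+\bar\alpha\lambda+\bar\phi^f_{\bar x}(\lambda).$$ Equivalently, $\bar\lambda$ is the unique root of the strictly decreasing function $0<\lambda\mapsto f(P_\lambda f(\bar x))-\lambda-\bar\alpha$.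
   Context: $\Gamma_0(\mathbb{E})$ denotes the closed proper convex functions $\mathbb{E}\to\mathbb{R}\cup\{+\infty\}$; $\mathrm{epi} f=\{(x,\alpha)\in\mathbb{E}\times\mathbb{R}\mid f(x)\le\alpha\}$. For $\lambda>0$, $e_\lambda f(x)=\min_u\{f(u)+\frac1{2\lambda}\|x-u\|^2\}$ and $P_\lambda f(x)$ is the unique minimizer. $P_C$, $d_C$ are the Euclidean projection onto and distance to a closed convex set $C$. The function $\bar\phi^f_{\bar x}:\mathbb{R}\to\mathbb{R}\cup\{+\infty\}$ is $$\bar\phi^f_{\bar x}(\lambda)=\begin{cases}-\lambda e_\lambda f(\bar x)&\lambda>0,\\-\frac12d^2_{\mathrm{cl}(\mathrm{dom} f)}(\bar x)&\lambda=0,\\-\lambda f(P_{\mathrm{cl}(\mathrm{dom} f)}(\bar x))-\frac12d^2_{\mathrm{cl}(\mathrm{dom} f)}(\bar x)&\lambda<0.\end{cases}$$ *)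

theory Defs
  imports "HOL-Analysis.Analysis"
begin

text \<open>
  Functions with values in the reals extended by plus infinity are rendered as
  \<open>ereal\<close>-valued functions; the value minus infinity is excluded by properness.
  Projection onto and distance to a closed convex nonempty set are the library's
  \<^const>\<open>closest_point\<close> and \<^const>\<open>infdist\<close>.
\<close>

definition epi :: "('a \<Rightarrow> ereal) \<Rightarrow> ('a \<times> real) set" where
  "epi f = {(x, \<alpha>). f x \<le> ereal \<alpha>}"

definition effdom :: "('a \<Rightarrow> ereal) \<Rightarrow> 'a set" where
  "effdom f = {x. f x < \<infinity>}"

definition proper :: "('a \<Rightarrow> ereal) \<Rightarrow> bool" where
  "proper f \<longleftrightarrow> (\<forall>x. f x \<noteq> -\<infinity>) \<and> effdom f \<noteq> {}"

definition Gamma0 :: "('a::euclidean_space \<Rightarrow> ereal) set" where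
  "Gamma0 = {f. proper f \<and> closed (epi f) \<and> convex (epi f)}"

definition prox_objective :: "('a::euclidean_space \<Rightarrow> ereal) \<Rightarrow> real \<Rightarrow> 'a \<Rightarrow> 'a \<Rightarrow> ereal" where
  "prox_objective f l x u = f u + ereal (1 / (2 * l) * (norm (x - u))\<^sup>2)"

text \<open>
  For \<open>f \<in> Gamma0\<close> and \<open>l > 0\<close> the infimum in the envelope is attained, at
  exactly one point, which is the proximal point.
\<close>

definition moreau_env :: "('a::euclidean_space \<Rightarrow> ereal) \<Rightarrow> real \<Rightarrow> 'a \<Rightarrow> ereal" where
  "moreau_env f l x = (INF u. prox_objective f l x u)"

definition prox :: "('a::euclidean_space \<Rightarrow> ereal) \<Rightarrow> real \<Rightarrow> 'a \<Rightarrow> 'a" where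
  "prox f l x = (THE u. is_arg_min (prox_objective f l x) (\<lambda>_. True) u)"

text \<open>
  In the last case \<open>f\<close> may be infinite at the projection; as \<open>- l > 0\<close> there,
  the value is then \<open>\<infinity>\<close>.
\<close>

definition phi_bar :: "('a::euclidean_space \<Rightarrow> ereal) \<Rightarrow> 'a \<Rightarrow> real \<Rightarrow> ereal" where
  "phi_bar f x l =
    (if l > 0 then ereal (- l) * moreau_env f l x
     else if l = 0 then - ereal (1 / 2 * (infdist x (closure (effdom f)))\<^sup>2)
     else ereal (- l) * f (closest_point (closure (effdom f)) x)
            - ereal (1 / 2 * (infdist x (closure (effdom f)))\<^sup>2))"

definition dual_objective :: "('a::euclidean_space \<Rightarrow> ereal) \<Rightarrow> 'a \<Rightarrow> real \<Rightarrow> real \<Rightarrow> ereal" where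
  "dual_objective f x \<alpha> l = phi_bar f x l + ereal (\<alpha> * l) + ereal (1 / 2 * l\<^sup>2)"

definition strongly_convex :: "('a::real_normed_vector \<Rightarrow> ereal) \<Rightarrow> bool" where
  "strongly_convex g \<longleftrightarrow> (\<forall>x. g x \<noteq> -\<infinity>) \<and>
    (\<exists>m>0. \<forall>x y. \<forall>u\<ge>0. \<forall>v\<ge>0. u + v = 1 \<longrightarrow>
       g (u *\<^sub>R x + v *\<^sub>R y) + ereal (m / 2 * u * v * (norm (x - y))\<^sup>2)
         \<le> ereal u * g x + ereal v * g y)"

end

theory Submission
  imports Defs
begin

text \<open>
  Let \<open>D = closure (effdom f)\<close> and let \<open>p\<close> be the projection of \<open>x\<close> onto \<open>D\<close>. For
  \<open>l \<ge> 0\<close> the value \<open>phi_bar f x l\<close> is the supremum over \<open>u \<in> effdom f\<close> of the affine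
  functions \<open>- l * f u - 1/2 * (norm (x - u))\<^sup>2\<close> of \<open>l\<close> (\<open>phi_bar_ge\<close>); at \<open>k > 0\<close> it
  is attained at \<open>u = prox f k x\<close>. The function touching at \<open>k\<close> is a minorant of
  \<open>phi_bar f x\<close> on the whole line (\<open>phi_bar_ge_prox\<close>), and if \<open>f p\<close> is finite then the
  one of \<open>u = p\<close> is a minorant that touches at every \<open>l \<le> 0\<close> (\<open>phi_bar_ge_proj\<close>).
  Adding \<open>1/2 * l\<^sup>2\<close> to a function with touching affine minorants gives strong convexity
  with modulus \<open>1\<close>. Such a minorant can be missing at \<open>0\<close> when \<open>f p\<close> is infinite, but
  then \<open>phi_bar f x\<close> is infinite on the negative half-line and the point \<open>0\<close> is harmless.

  If \<open>f p \<le> \<alpha>\<close>, then \<open>(p, \<alpha>)\<close> is the point of the epigraph closest to \<open>(x, \<alpha>)\<close>,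
  and the minorant of \<open>p\<close> shows that \<open>l = 0\<close> minimizes the dual objective. Otherwise the
  variational inequality at the closest point \<open>(y, \<beta>)\<close> forces \<open>\<beta> > \<alpha>\<close> and
  \<open>f y = \<beta>\<close>, and says exactly that \<open>(x - y) / l\<close> is a subgradient of \<open>f\<close> at \<open>y\<close>
  for \<open>l = \<beta> - \<alpha>\<close>, that is, \<open>y = prox f l x\<close> (\<open>closest_point_epi_prox\<close>). The
  minorant of \<open>y\<close> then bounds the dual objective at \<open>k \<ge> 0\<close> from below by
  \<open>1/2 * (k - l)\<^sup>2\<close> minus half the squared distance to the epigraph, with equality at
  \<open>k = l\<close> (\<open>dual_objective_prox\<close>), so \<open>l\<close> is the only minimizer. It is the only root
  because \<open>l \<mapsto> f (prox f l x)\<close> is nonincreasing.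
\<close>

section \<open>Functions with a closed convex epigraph\<close>

lemma mem_epi: "(u, \<gamma>) \<in> epi f \<longleftrightarrow> f u \<le> ereal \<gamma>"
  by (simp add: epi_def)

lemma effdom_eq_fst_epi: "effdom f = fst ` epi f"
proof (intro subset_antisym subsetI)
  fix u assume "u \<in> effdom f"
  then have "f u < \<infinity>" by (simp add: effdom_def)
  then obtain \<gamma> where "f u \<le> ereal \<gamma>"
    by (cases "f u") auto
  then have "(u, \<gamma>) \<in> epi f" by (simp add: mem_epi)
  then show "u \<in> fst ` epi f" by force
next
  fix u assume "u \<in> fst ` epi f"
  then obtain \<gamma> where "f u \<le> ereal \<gamma>" by (auto simp: epi_def)
  then show "u \<in> effdom f"
    using le_less_trans[of "f u" "ereal \<gamma>" \<infinity>] by (simp add: effdom_def)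
qed

context
  fixes f :: "'a::euclidean_space \<Rightarrow> ereal"
  assumes f: "f \<in> Gamma0"
begin

lemma Gamma0_not_MInf: "f u \<noteq> -\<infinity>"
  using f by (auto simp: Gamma0_def proper_def)

lemma Gamma0_real: "u \<in> effdom f \<Longrightarrow> f u = ereal (real_of_ereal (f u))"
  using Gamma0_not_MInf[of u] by (cases "f u") (auto simp: effdom_def)

lemma Gamma0_infinite: "u \<notin> effdom f \<Longrightarrow> f u = \<infinity>"
  by (simp add: effdom_def)

lemma effdom_nonempty: "effdom f \<noteq> {}"
  using f by (auto simp: Gamma0_def proper_def)

lemma closed_epi: "closed (epi f)"
  and convex_epi: "convex (epi f)"
  using f by (auto simp: Gamma0_def)

lemma epi_nonempty: "epi f \<noteq> {}"
  using effdom_nonempty by (simp add: effdom_eq_fst_epi)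

lemma convex_effdom: "convex (effdom f)"
  unfolding effdom_eq_fst_epi by (intro convex_linear_image linear_fst convex_epi)

lemma mem_epi_real: "u \<in> effdom f \<Longrightarrow> (u, real_of_ereal (f u)) \<in> epi f"
  using Gamma0_real[of u] by (simp add: mem_epi)

lemma epi_imp_effdom: "(u, \<gamma>) \<in> epi f \<Longrightarrow> u \<in> effdom f"
  by (force simp: effdom_eq_fst_epi)

lemma mem_epi_iff: "(u, \<gamma>) \<in> epi f \<longleftrightarrow> u \<in> effdom f \<and> real_of_ereal (f u) \<le> \<gamma>"
  by (metis Gamma0_real epi_imp_effdom ereal_less_eq(3) mem_epi)

text \<open>
  Below, \<open>real_of_ereal (f u)\<close> is used for the value of \<open>f\<close> at points of \<open>effdom f\<close>
  only; its default value \<open>0\<close> at the other points plays no role.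

  The projection onto the epigraph of a point strictly below the graph yields the normal
  vector of a nonvertical supporting hyperplane.
\<close>

lemma affine_minorant:
  obtains a b where "\<And>u \<gamma>. (u, \<gamma>) \<in> epi f \<Longrightarrow> a \<bullet> u + b \<le> \<gamma>"
proof -
  obtain x0 where x0: "x0 \<in> effdom f" using effdom_nonempty by auto
  define r where "r = real_of_ereal (f x0)"
  obtain y \<beta> where yb: "closest_point (epi f) (x0, r - 1) = (y, \<beta>)" by fastforce
  have mem: "(y, \<beta>) \<in> epi f"
    using closest_point_in_set[OF closed_epi epi_nonempty] yb by metis
  have var: "(x0 - y) \<bullet> (u - y) + (r - 1 - \<beta>) * (\<gamma> - \<beta>) \<le> 0" if "(u, \<gamma>) \<in> epi f" for u \<gamma>
    using closest_point_dot[OF convex_epi closed_epi that, of "(x0, r - 1)"] yb by simp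
  define s where "s = r - 1 - \<beta>"
  have "(x0, r) \<in> epi f" using mem_epi_real[OF x0] by (simp add: r_def)
  from var[OF this] have q: "(norm (x0 - y))\<^sup>2 + s * (s + 1) \<le> 0"
    by (simp add: s_def power2_norm_eq_inner algebra_simps)
  \<comment> \<open>The normal vector \<open>(x0 - y, s)\<close> is not horizontal, since \<open>x0\<close> lies in the domain.\<close>
  have s0: "s < 0"
  proof (rule ccontr)
    assume "\<not> s < 0"
    then have "s * (s + 1) \<ge> 0" "s * s \<le> s * (s + 1)" by (auto simp: algebra_simps)
    with q have "(norm (x0 - y))\<^sup>2 = 0" "s * (s + 1) = 0"
      by (smt (verit) zero_le_power2)+
    with \<open>\<not> s < 0\<close> have "x0 = y" "s = 0" by auto
    then have "(x0, r - 1) \<in> epi f" using mem by (simp add: s_def)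
    then show False by (simp add: mem_epi_iff r_def)
  qed
  show thesis
  proof (rule that)
    fix u \<gamma> assume "(u, \<gamma>) \<in> epi f"
    from var[OF this] have "(x0 - y) \<bullet> (u - y) \<le> (- s) * (\<gamma> - \<beta>)"
      by (simp add: s_def algebra_simps)
    then have "((x0 - y) \<bullet> (u - y)) / (- s) \<le> \<gamma> - \<beta>"
      using s0 by (simp add: divide_simps mult.commute)
    moreover have "((x0 - y) /\<^sub>R (- s)) \<bullet> u = (x0 - y) \<bullet> u / (- s)"
      by (simp only: inner_scaleR_left divide_inverse mult.commute)
    ultimately show "((x0 - y) /\<^sub>R (- s)) \<bullet> u + (\<beta> - (x0 - y) \<bullet> y / (- s)) \<le> \<gamma>"
      by (simp add: inner_diff_right[of _ u y] diff_divide_distrib)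
  qed
qed

section \<open>Proximal points\<close>

text \<open>
  The quadratic term beats the affine minorant, so the sublevel sets, taken in the epigraph,
  are compact.
\<close>

lemma prox_minimizer_exists:
  assumes l: "0 < l"
  obtains y where "y \<in> effdom f"
    "\<And>u. u \<in> effdom f \<Longrightarrow> real_of_ereal (f y) + 1 / (2 * l) * (norm (x - y))\<^sup>2
       \<le> real_of_ereal (f u) + 1 / (2 * l) * (norm (x - u))\<^sup>2"
proof -
  obtain a b where ab: "\<And>u \<gamma>. (u, \<gamma>) \<in> epi f \<Longrightarrow> a \<bullet> u + b \<le> \<gamma>" using affine_minorant by blast
  obtain x0 where x0: "x0 \<in> effdom f" using effdom_nonempty by auto
  define c where "c = 1 / (2 * l)"
  have c: "c > 0" using l by (simp add: c_def)
  define h where "h = (\<lambda>p::'a \<times> real. snd p + c * (norm (x - fst p))\<^sup>2)"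
  have cont: "continuous_on S h" for S
    unfolding h_def by (intro continuous_intros)
  define M where "M = h (x0, real_of_ereal (f x0))"
  define K where "K = epi f \<inter> {p. h p \<le> M}"
  define N where "N = \<bar>M - b - a \<bullet> x\<bar>"
  define R where "R = 1 + (N + norm a) / c"
  have "closed K"
    unfolding K_def by (intro closed_Int closed_epi closed_Collect_le cont continuous_on_const)
  moreover have "K \<subseteq> cball x R \<times> {a \<bullet> x - norm a * R + b .. M}"
  proof
    fix p assume p: "p \<in> K"
    obtain u \<gamma> where ug: "p = (u, \<gamma>)" by fastforce
    have e: "a \<bullet> u + b \<le> \<gamma>" and le: "\<gamma> + c * (norm (x - u))\<^sup>2 \<le> M"
      using p ab by (auto simp: K_def ug h_def)
    have cs: "a \<bullet> x - norm a * norm (x - u) \<le> a \<bullet> u"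
      using norm_cauchy_schwarz[of a "x - u"] by (simp add: inner_diff_right)
    have r: "norm (x - u) \<le> R"
    proof (cases "norm (x - u) \<le> 1")
      case True
      then show ?thesis using c by (smt (verit) R_def N_def abs_ge_zero divide_nonneg_pos norm_ge_zero)
    next
      case False
      have "c * norm (x - u) * norm (x - u) \<le> N + norm a * norm (x - u)"
        using e le cs by (simp add: N_def power2_eq_square mult.assoc)
      also have "\<dots> \<le> (N + norm a) * norm (x - u)"
        using False mult_left_mono[of 1 "norm (x - u)" N] by (simp add: distrib_right N_def)
      finally have "c * norm (x - u) \<le> N + norm a"
        by (rule mult_right_le_imp_le) (use False in linarith)
      then show ?thesis using c by (simp add: R_def field_simps)
    qed
    have "norm a * norm (x - u) \<le> norm a * R" by (intro mult_left_mono r) simp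
    moreover have "0 \<le> c * (norm (x - u))\<^sup>2" using c by simp
    ultimately show "p \<in> cball x R \<times> {a \<bullet> x - norm a * R + b .. M}"
      using e le cs r by (auto simp: ug dist_norm)
  qed
  ultimately have "compact K"
    by (metis bounded_subset compact_Times compact_cball compact_Icc compact_eq_bounded_closed)
  moreover have mem0: "(x0, real_of_ereal (f x0)) \<in> K"
    using mem_epi_real[OF x0] by (simp add: K_def M_def)
  ultimately obtain p where p: "p \<in> K" and min: "\<And>q. q \<in> K \<Longrightarrow> h p \<le> h q"
    using continuous_attains_inf[OF _ _ cont] by (metis empty_iff)
  obtain y \<beta> where yb: "p = (y, \<beta>)" by fastforce
  have y: "y \<in> effdom f" "real_of_ereal (f y) \<le> \<beta>"
    using p by (auto simp: yb K_def mem_epi_iff)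
  have glob: "h p \<le> h q" if "q \<in> epi f" for q
    using that min[of q] min[OF mem0] by (cases "h q \<le> M") (auto simp: K_def M_def)
  show thesis
  proof (rule that[OF y(1)])
    fix u assume "u \<in> effdom f"
    from glob[OF mem_epi_real[OF this]] y(2)
    show "real_of_ereal (f y) + 1 / (2 * l) * (norm (x - y))\<^sup>2
       \<le> real_of_ereal (f u) + 1 / (2 * l) * (norm (x - u))\<^sup>2"
      by (simp add: h_def yb c_def)
  qed
qed

lemma norm_midpoint_power2:
  fixes x y z :: 'a
  shows "(norm (x - midpoint y z))\<^sup>2
     = ((norm (x - y))\<^sup>2 + (norm (x - z))\<^sup>2) / 2 - (norm (y - z))\<^sup>2 / 4"
  by (simp add: power2_norm_eq_inner midpoint_def inner_diff_left inner_diff_right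
      inner_add_left inner_add_right inner_commute field_simps)

lemma prox_minimizer_unique:
  assumes l: "0 < l" and y: "y \<in> effdom f" and z: "z \<in> effdom f"
    and miny: "\<And>u. u \<in> effdom f \<Longrightarrow> real_of_ereal (f y) + 1 / (2 * l) * (norm (x - y))\<^sup>2
       \<le> real_of_ereal (f u) + 1 / (2 * l) * (norm (x - u))\<^sup>2"
    and minz: "\<And>u. u \<in> effdom f \<Longrightarrow> real_of_ereal (f z) + 1 / (2 * l) * (norm (x - z))\<^sup>2
       \<le> real_of_ereal (f u) + 1 / (2 * l) * (norm (x - u))\<^sup>2"
  shows "y = z"
proof -
  define c where "c = 1 / (2 * l)"
  have c: "c > 0" using l by (simp add: c_def)
  \<comment> \<open>The midpoint of two distinct minimizers would have a strictly smaller value.\<close>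
  have "(1/2) *\<^sub>R (y, real_of_ereal (f y)) + (1/2) *\<^sub>R (z, real_of_ereal (f z)) \<in> epi f"
    by (intro convexD[OF convex_epi] mem_epi_real y z) auto
  then have "(midpoint y z, (real_of_ereal (f y) + real_of_ereal (f z)) / 2) \<in> epi f"
    by (simp add: midpoint_def scaleR_add_right add_divide_distrib)
  then have w: "midpoint y z \<in> effdom f"
    "real_of_ereal (f (midpoint y z)) \<le> (real_of_ereal (f y) + real_of_ereal (f z)) / 2"
    by (auto simp: mem_epi_iff)
  have "4 * (c * (norm (x - midpoint y z))\<^sup>2)
     = 2 * (c * (norm (x - y))\<^sup>2) + 2 * (c * (norm (x - z))\<^sup>2) - c * (norm (y - z))\<^sup>2"
    by (simp add: norm_midpoint_power2 field_simps)
  moreover have "real_of_ereal (f y) + c * (norm (x - y))\<^sup>2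
      + (real_of_ereal (f z) + c * (norm (x - z))\<^sup>2)
      \<le> 2 * real_of_ereal (f (midpoint y z)) + 2 * (c * (norm (x - midpoint y z))\<^sup>2)"
    using add_mono[OF miny[OF w(1)] minz[OF w(1)]] by (simp add: c_def)
  ultimately have "c * (norm (y - z))\<^sup>2 \<le> 0"
    using w(2) by argo
  then show ?thesis using c by (simp add: mult_le_0_iff)
qed

lemma prox_objective_le_iff:
  assumes "y \<in> effdom f"
  shows "(\<forall>u. prox_objective f l x y \<le> prox_objective f l x u) \<longleftrightarrow>
    (\<forall>u\<in>effdom f. real_of_ereal (f y) + 1 / (2 * l) * (norm (x - y))\<^sup>2
       \<le> real_of_ereal (f u) + 1 / (2 * l) * (norm (x - u))\<^sup>2)"
proof -
  have fin: "prox_objective f l x u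
      = ereal (real_of_ereal (f u) + 1 / (2 * l) * (norm (x - u))\<^sup>2)" if "u \<in> effdom f" for u
    unfolding prox_objective_def by (subst Gamma0_real[OF that]) simp
  have inf: "prox_objective f l x u = \<infinity>" if "u \<notin> effdom f" for u
    by (simp add: prox_objective_def Gamma0_infinite[OF that])
  show ?thesis
  proof (intro iffI ballI allI)
    fix u assume "\<forall>u. prox_objective f l x y \<le> prox_objective f l x u" "u \<in> effdom f"
    then show "real_of_ereal (f y) + 1 / (2 * l) * (norm (x - y))\<^sup>2
       \<le> real_of_ereal (f u) + 1 / (2 * l) * (norm (x - u))\<^sup>2"
      using fin assms by (metis ereal_less_eq(3))
  next
    fix u assume *: "\<forall>u\<in>effdom f. real_of_ereal (f y) + 1 / (2 * l) * (norm (x - y))\<^sup>2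
       \<le> real_of_ereal (f u) + 1 / (2 * l) * (norm (x - u))\<^sup>2"
    show "prox_objective f l x y \<le> prox_objective f l x u"
    proof (cases "u \<in> effdom f")
      case True
      with * show ?thesis by (simp only: fin assms ereal_less_eq(3))
    qed (simp add: inf)
  qed
qed

lemma prox_eqI:
  assumes l: "0 < l" and y: "y \<in> effdom f"
    and min: "\<And>u. u \<in> effdom f \<Longrightarrow> real_of_ereal (f y) + 1 / (2 * l) * (norm (x - y))\<^sup>2
       \<le> real_of_ereal (f u) + 1 / (2 * l) * (norm (x - u))\<^sup>2"
  shows "prox f l x = y"
  unfolding prox_def
proof (rule the_equality)
  have *: "\<forall>u. prox_objective f l x y \<le> prox_objective f l x u"
    using prox_objective_le_iff[OF y] min by blast
  then show "is_arg_min (prox_objective f l x) (\<lambda>_. True) y"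
    by (simp add: is_arg_min_linorder)
  fix z assume "is_arg_min (prox_objective f l x) (\<lambda>_. True) z"
  then have z: "\<forall>u. prox_objective f l x z \<le> prox_objective f l x u"
    by (simp add: is_arg_min_linorder)
  have zd: "z \<in> effdom f"
  proof (rule ccontr)
    assume "z \<notin> effdom f"
    then have "prox_objective f l x z = \<infinity>"
      by (simp add: prox_objective_def Gamma0_infinite)
    with z have "prox_objective f l x y = \<infinity>" by (metis ereal_infty_less_eq(1))
    then show False using y by (auto simp: prox_objective_def effdom_def)
  qed
  show "z = y"
    using prox_minimizer_unique[OF l zd y _ min] prox_objective_le_iff[OF zd] z by blast
qed

lemma prox_in_effdom: "0 < l \<Longrightarrow> prox f l x \<in> effdom f"
  and prox_minimizes: "\<lbrakk>0 < l; u \<in> effdom f\<rbrakk> \<Longrightarrow>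
     real_of_ereal (f (prox f l x)) + 1 / (2 * l) * (norm (x - prox f l x))\<^sup>2
       \<le> real_of_ereal (f u) + 1 / (2 * l) * (norm (x - u))\<^sup>2"
  using prox_minimizer_exists[of l x] prox_eqI[of l _ x] by metis+

lemma prox_minimizes_scaled:
  assumes l: "0 < l" and u: "u \<in> effdom f"
  shows "l * real_of_ereal (f (prox f l x)) + 1 / 2 * (norm (x - prox f l x))\<^sup>2
       \<le> l * real_of_ereal (f u) + 1 / 2 * (norm (x - u))\<^sup>2"
proof -
  have eq: "l * (a + 1 / (2 * l) * b) = l * a + 1 / 2 * b" for a b
    using l by (simp add: distrib_left)
  show ?thesis
    using mult_left_mono[OF prox_minimizes[OF l u, of x], of l] l unfolding eq by simp
qed

lemma moreau_env_eq:
  assumes l: "0 < l"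
  shows "moreau_env f l x
    = ereal (real_of_ereal (f (prox f l x)) + 1 / (2 * l) * (norm (x - prox f l x))\<^sup>2)"
proof -
  note dom = prox_in_effdom[OF l]
  have "\<forall>u. prox_objective f l x (prox f l x) \<le> prox_objective f l x u"
    using prox_objective_le_iff[OF dom] prox_minimizes[OF l] by blast
  then have "moreau_env f l x = prox_objective f l x (prox f l x)"
    unfolding moreau_env_def by (intro antisym INF_greatest INF_lower) auto
  then show ?thesis
    unfolding prox_objective_def by (subst (asm) Gamma0_real[OF dom]) simp
qed

lemma real_prox_antimono:
  assumes "0 < k" "k < l"
  shows "real_of_ereal (f (prox f l x)) \<le> real_of_ereal (f (prox f k x))"
proof -
  \<comment> \<open>Adding the two optimality inequalities, each tested at the other proximal point, cancels
    the norms.\<close>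
  have "(l - k) * (real_of_ereal (f (prox f l x)) - real_of_ereal (f (prox f k x))) \<le> 0"
    using prox_minimizes_scaled[of l "prox f k x" x] prox_minimizes_scaled[of k "prox f l x" x]
      prox_in_effdom[of k x] prox_in_effdom[of l x] assms
    by (simp add: algebra_simps)
  then show ?thesis using assms by (simp add: mult_le_0_iff)
qed

lemma strict_antimono_prox_residual:
  "strict_antimono_on {0<..} (\<lambda>l. f (prox f l x) - ereal l - ereal \<alpha>)"
proof (rule monotone_onI)
  fix k l :: real assume "k \<in> {0<..}" "l \<in> {0<..}" "k < l"
  then have k: "0 < k" and l: "0 < l" and kl: "k < l" by auto
  show "f (prox f k x) - ereal k - ereal \<alpha> > f (prox f l x) - ereal l - ereal \<alpha>"
    using real_prox_antimono[OF k kl, of x] kl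
    by (subst (1 2) Gamma0_real[OF prox_in_effdom]) (auto simp: k l)
qed

section \<open>Affine minorants of \<open>phi_bar\<close>\<close>

lemma phi_bar_pos:
  assumes l: "0 < l"
  shows "phi_bar f x l
    = ereal (- l * real_of_ereal (f (prox f l x)) - 1 / 2 * (norm (x - prox f l x))\<^sup>2)"
  using l by (simp add: phi_bar_def moreau_env_eq field_simps)

lemma infdist_closure_effdom:
  "infdist x (closure (effdom f)) = norm (x - closest_point (closure (effdom f)) x)"
  using setdist_closest_point[of "closure (effdom f)" x] effdom_nonempty
  by (simp add: infdist_eq_setdist dist_norm)

lemma phi_bar_nonpos:
  assumes l: "l \<le> 0" and p: "p = closest_point (closure (effdom f)) x" and dom: "p \<in> effdom f"
  shows "phi_bar f x l = ereal (- l * real_of_ereal (f p) - 1 / 2 * (norm (x - p))\<^sup>2)"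
proof -
  have "phi_bar f x l = ereal (- l) * f p - ereal (1 / 2 * (norm (x - p))\<^sup>2)"
  proof (cases "l = 0")
    case True
    then show ?thesis by (subst Gamma0_real[OF dom]) (simp add: phi_bar_def infdist_closure_effdom p)
  next
    case False
    then show ?thesis using l by (simp add: phi_bar_def infdist_closure_effdom p)
  qed
  then show ?thesis by (subst (asm) Gamma0_real[OF dom]) simp
qed

lemma phi_bar_neg_infinite:
  assumes "l < 0" "closest_point (closure (effdom f)) x \<notin> effdom f"
  shows "phi_bar f x l = \<infinity>"
  using assms by (simp add: phi_bar_def Gamma0_infinite)

lemma phi_bar_zero:
  "phi_bar f x 0 = ereal (- 1 / 2 * (norm (x - closest_point (closure (effdom f)) x))\<^sup>2)"
  by (simp add: phi_bar_def infdist_closure_effdom)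

lemma phi_bar_ge:
  assumes l: "0 \<le> l" and u: "u \<in> effdom f"
  shows "ereal (- l * real_of_ereal (f u) - 1 / 2 * (norm (x - u))\<^sup>2) \<le> phi_bar f x l"
proof (cases "l = 0")
  case True
  have "dist x (closest_point (closure (effdom f)) x) \<le> dist x u"
    using closure_subset u by (intro closest_point_le) auto
  then show ?thesis by (simp add: True phi_bar_zero dist_norm power_mono)
next
  case False
  then show ?thesis
    using l prox_minimizes_scaled[of l u x] u by (simp add: phi_bar_pos)
qed

text \<open>
  Since \<open>prox f k x\<close> is at least as far from \<open>x\<close> as the projection \<open>p\<close>, its
  value under \<open>f\<close> is at most \<open>f p\<close>; hence the affine function touching at
  \<open>k > 0\<close> remains a minorant on the negative half-line.
\<close>

lemma phi_bar_ge_prox: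
  assumes k: "0 < k"
  shows "ereal (- l * real_of_ereal (f (prox f k x)) - 1 / 2 * (norm (x - prox f k x))\<^sup>2)
     \<le> phi_bar f x l"
proof (cases "0 \<le> l")
  case True
  then show ?thesis by (intro phi_bar_ge prox_in_effdom k)
next
  case l: False
  define p where "p = closest_point (closure (effdom f)) x"
  show ?thesis
  proof (cases "p \<in> effdom f")
    case False
    then show ?thesis using l phi_bar_neg_infinite[of l x] by (simp add: p_def)
  next
    case True
    define y where "y = prox f k x"
    have "dist x p \<le> dist x y"
      unfolding p_def using closure_subset prox_in_effdom[OF k]
      by (intro closest_point_le) (auto simp: y_def)
    then have n: "(norm (x - p))\<^sup>2 \<le> (norm (x - y))\<^sup>2" by (simp add: dist_norm power_mono)
    with prox_minimizes_scaled[OF k True, of x]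
    have "k * real_of_ereal (f y) \<le> k * real_of_ereal (f p)" unfolding y_def by linarith
    then have "real_of_ereal (f y) \<le> real_of_ereal (f p)" using k by simp
    then have "- l * real_of_ereal (f y) \<le> - l * real_of_ereal (f p)"
      using l by (intro mult_left_mono) auto
    with n have "- l * real_of_ereal (f y) - 1 / 2 * (norm (x - y))\<^sup>2
        \<le> - l * real_of_ereal (f p) - 1 / 2 * (norm (x - p))\<^sup>2"
      by linarith
    then show ?thesis
      using l by (subst phi_bar_nonpos[OF _ p_def True]) (auto simp only: y_def ereal_less_eq)
  qed
qed

lemma phi_bar_ge_proj:
  assumes p: "p = closest_point (closure (effdom f)) x" and dom: "p \<in> effdom f"
  shows "ereal (- l * real_of_ereal (f p) - 1 / 2 * (norm (x - p))\<^sup>2) \<le> phi_bar f x l"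
  using phi_bar_ge[OF _ dom, of l x] phi_bar_nonpos[OF _ p dom, of l]
  by (cases "0 \<le> l") auto

lemma phi_bar_not_MInf: "phi_bar f x l \<noteq> -\<infinity>"
  using phi_bar_ge_prox[of 1 l x] by auto

section \<open>Strong convexity of the dual objective\<close>

text \<open>
  The only point of finite value that may lack a touching affine minorant is \<open>z = 0\<close>, when
  \<open>f\<close> is infinite at the projection. Then the function is infinite on the negative half-line,
  so \<open>0\<close> is not a proper convex combination of distinct points of finite value.
\<close>

lemma phi_bar_touching:
  assumes "closest_point (closure (effdom f)) x \<in> effdom f \<or> 0 < z"
  obtains A B where "phi_bar f x z = ereal (A + B * z)" "\<And>l. ereal (A + B * l) \<le> phi_bar f x l"
proof (cases "0 < z")
  case True
  define y where "y = prox f z x"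
  show thesis
    using phi_bar_pos[OF True, of x] phi_bar_ge_prox[OF True, of _ x]
    by (intro that[of "- 1 / 2 * (norm (x - y))\<^sup>2" "- real_of_ereal (f y)"])
      (simp_all add: y_def algebra_simps)
next
  case False
  define p where "p = closest_point (closure (effdom f)) x"
  have dom: "p \<in> effdom f" using assms False by (simp add: p_def)
  show thesis
    using phi_bar_nonpos[OF _ p_def dom, of z] phi_bar_ge_proj[OF p_def dom] False
    by (intro that[of "- 1 / 2 * (norm (x - p))\<^sup>2" "- real_of_ereal (f p)"])
      (simp_all add: algebra_simps)
qed

lemma strongly_convex_dual_objective: "strongly_convex (dual_objective f x \<alpha>)"
  unfolding strongly_convex_def
proof (intro conjI exI[of _ "1::real"] allI impI)
  fix l
  show "dual_objective f x \<alpha> l \<noteq> -\<infinity>"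
    using phi_bar_not_MInf[of x l] by (cases "phi_bar f x l") (auto simp: dual_objective_def)
next
  let ?g = "dual_objective f x \<alpha>"
  let ?q = "\<lambda>l. \<alpha> * l + 1 / 2 * l\<^sup>2"
  have g: "?g l = phi_bar f x l + ereal (?q l)" for l
    by (simp add: dual_objective_def add.assoc)
  have gMInf: "?g l \<noteq> -\<infinity>" for l
    using phi_bar_not_MInf[of x l] by (cases "phi_bar f x l") (auto simp: g)
  fix l k u v :: real
  assume u: "0 \<le> u" and v: "0 \<le> v" and uv: "u + v = 1"
  let ?z = "u *\<^sub>R l + v *\<^sub>R k"
  show "?g ?z + ereal (1 / 2 * u * v * (norm (l - k))\<^sup>2) \<le> ereal u * ?g l + ereal v * ?g k"
  proof (cases "u = 0 \<or> v = 0 \<or> l = k \<or> ?g l = \<infinity> \<or> ?g k = \<infinity>")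
    case True
    consider "u = 0" | "v = 0" | "l = k" | "u > 0" "v > 0" "?g l = \<infinity> \<or> ?g k = \<infinity>"
      using True u v by linarith
    then show ?thesis
    proof cases
      case 3
      have "u * l + v * l = l" using uv by (metis distrib_right mult_1)
      with 3 show ?thesis
        using gMInf[of l] uv u v
        by (cases "?g l") (auto simp: zero_ereal_def[symmetric] distrib_right[symmetric])
    next
      case 4
      then show ?thesis
        using gMInf[of l] gMInf[of k] by (cases "?g l"; cases "?g k") auto
    qed (use uv in \<open>auto simp: zero_ereal_def[symmetric] one_ereal_def[symmetric]\<close>)
  next
    case False
    then have uv0: "u > 0" "v > 0" and lk: "l \<noteq> k" and fin: "?g l \<noteq> \<infinity>" "?g k \<noteq> \<infinity>"
      using u v by auto
    have "closest_point (closure (effdom f)) x \<in> effdom f \<or> 0 < ?z"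
    proof (cases "closest_point (closure (effdom f)) x \<in> effdom f")
      case False
      have "0 \<le> l" "0 \<le> k"
        using fin phi_bar_neg_infinite[OF _ False] by (force simp: g not_less[symmetric])+
      with lk uv0 show ?thesis
        by (smt (verit) mult_pos_pos mult_nonneg_nonneg real_scaleR_def)
    qed simp
    then obtain A B where AB: "phi_bar f x ?z = ereal (A + B * ?z)"
      "\<And>l. ereal (A + B * l) \<le> phi_bar f x l"
      using phi_bar_touching by blast
    obtain a where a: "?g l = ereal a" using gMInf[of l] fin(1) by (cases "?g l") auto
    obtain b where b: "?g k = ereal b" using gMInf[of k] fin(2) by (cases "?g k") auto
    have "A + B * l + ?q l \<le> a"
      using AB(2)[of l] a by (cases "phi_bar f x l") (auto simp: g)
    moreover have "A + B * k + ?q k \<le> b"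
      using AB(2)[of k] b by (cases "phi_bar f x k") (auto simp: g)
    ultimately have le: "u * (A + B * l + ?q l) + v * (A + B * k + ?q k) \<le> u * a + v * b"
      using u v by (intro add_mono mult_left_mono)
    have u1: "u = 1 - v" using uv by simp
    have "A + B * ?z + ?q ?z + 1 / 2 * u * v * (l - k)\<^sup>2
        = u * (A + B * l + ?q l) + v * (A + B * k + ?q k)"
      unfolding u1 real_scaleR_def by (simp add: power2_eq_square field_simps)
    moreover have "?g ?z = ereal (A + B * ?z + ?q ?z)"
      by (simp only: g AB(1) plus_ereal.simps)
    ultimately show ?thesis using le by (simp add: a b)
  qed
qed simp

section \<open>Projection onto the epigraph\<close>

lemma infdist_epi: "infdist q (epi f) = dist q (closest_point (epi f) q)"
  using setdist_closest_point[OF closed_epi epi_nonempty, of q] by (simp add: infdist_eq_setdist)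

lemma closest_point_epi_proj:
  assumes p: "p = closest_point (closure (effdom f)) x" and le: "f p \<le> ereal \<alpha>"
  shows "closest_point (epi f) (x, \<alpha>) = (p, \<alpha>)"
proof (rule closest_point_unique[symmetric, OF convex_epi closed_epi])
  show "(p, \<alpha>) \<in> epi f" using le by (simp add: mem_epi)
  show "\<forall>z\<in>epi f. dist (x, \<alpha>) (p, \<alpha>) \<le> dist (x, \<alpha>) z"
  proof
    fix z assume z: "z \<in> epi f"
    then have "fst z \<in> closure (effdom f)"
      using closure_subset[of "effdom f"] by (auto simp: effdom_eq_fst_epi)
    then have "dist x p \<le> dist x (fst z)" unfolding p by (intro closest_point_le) auto
    also have "\<dots> \<le> dist (x, \<alpha>) z" using dist_fst_le[of "(x, \<alpha>)" z] by simp
    finally show "dist (x, \<alpha>) (p, \<alpha>) \<le> dist (x, \<alpha>) z" by (simp add: dist_Pair_Pair)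
  qed
qed

lemma dual_objective_ge:
  assumes "0 \<le> l" "u \<in> effdom f"
  shows "ereal (- l * real_of_ereal (f u) - 1 / 2 * (norm (x - u))\<^sup>2 + \<alpha> * l + 1 / 2 * l\<^sup>2)
    \<le> dual_objective f x \<alpha> l"
  using add_right_mono[OF phi_bar_ge[OF assms, of x], of "ereal (\<alpha> * l + 1 / 2 * l\<^sup>2)"]
  by (simp add: dual_objective_def add.assoc)

text \<open>
  If the projection onto the closed domain is not already below height \<open>\<alpha>\<close>, the
  projection onto the epigraph lies on the graph, strictly above \<open>\<alpha>\<close>, and the variational
  inequality characterizing it is the optimality condition of a proximal point.
\<close>

lemma closest_point_epi_prox:
  assumes gt: "\<not> f (closest_point (closure (effdom f)) x) \<le> ereal \<alpha>"
  obtains l where "0 < l" "closest_point (epi f) (x, \<alpha>) = (prox f l x, \<alpha> + l)"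
    "f (prox f l x) = ereal (\<alpha> + l)"
proof -
  obtain y \<beta> where yb: "closest_point (epi f) (x, \<alpha>) = (y, \<beta>)" by fastforce
  have mem: "(y, \<beta>) \<in> epi f"
    using closest_point_in_set[OF closed_epi epi_nonempty] yb by metis
  then have y: "y \<in> effdom f" and fy: "real_of_ereal (f y) \<le> \<beta>" by (auto simp: mem_epi_iff)
  have var: "(x - y) \<bullet> (u - y) \<le> (\<beta> - \<alpha>) * (\<gamma> - \<beta>)" if "(u, \<gamma>) \<in> epi f" for u \<gamma>
    using closest_point_dot[OF convex_epi closed_epi that, of "(x, \<alpha>)"] yb
    by (simp add: algebra_simps)
  \<comment> \<open>The epigraph contains the upward ray from each of its points.\<close>
  have "(y, \<beta> + 1) \<in> epi f" using y fy by (simp add: mem_epi_iff)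
  from var[OF this] have "\<alpha> \<le> \<beta>" by simp
  moreover have "\<alpha> \<noteq> \<beta>"
  proof
    assume eq: "\<alpha> = \<beta>"
    \<comment> \<open>The inequality loses its vertical part and says that \<open>y\<close> is the projection of \<open>x\<close>.\<close>
    have "effdom f \<subseteq> {u. (x - y) \<bullet> u \<le> (x - y) \<bullet> y}"
      using var[OF mem_epi_real] by (auto simp: eq inner_diff_right)
    then have sub: "closure (effdom f) \<subseteq> {u. (x - y) \<bullet> u \<le> (x - y) \<bullet> y}"
      by (intro closure_minimal closed_halfspace_le)
    have "y = closest_point (closure (effdom f)) x"
    proof (rule closest_point_unique)
      show "convex (closure (effdom f))" by (intro convex_closure convex_effdom)
      show "\<forall>z\<in>closure (effdom f). dist x y \<le> dist x z"
      proof
        fix z assume "z \<in> closure (effdom f)"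
        then have "(x - y) \<bullet> (z - y) \<le> 0" using sub by (auto simp: inner_diff_right)
        then have "(norm (x - y))\<^sup>2 \<le> (norm (x - z))\<^sup>2 - (norm (z - y))\<^sup>2"
          by (simp add: power2_norm_eq_inner inner_diff_left inner_diff_right inner_commute)
        then have "(norm (x - y))\<^sup>2 \<le> (norm (x - z))\<^sup>2" by (smt (verit) zero_le_power2)
        then show "dist x y \<le> dist x z" by (simp add: dist_norm)
      qed
    qed (use y closure_subset in auto)
    then show False using gt mem by (simp add: eq mem_epi)
  qed
  ultimately have ab: "\<alpha> < \<beta>" by simp
  define l where "l = \<beta> - \<alpha>"
  have l: "0 < l" using ab by (simp add: l_def)
  \<comment> \<open>Testing with the point of the graph over \<open>y\<close> shows that \<open>(y, \<beta>)\<close> is on the graph.\<close>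
  have "0 \<le> l * (real_of_ereal (f y) - \<beta>)" using var[OF mem_epi_real[OF y]] by (simp add: l_def)
  then have fyb: "real_of_ereal (f y) = \<beta>" using fy l by (auto simp: zero_le_mult_iff)
  have "prox f l x = y"
  proof (rule prox_eqI[OF l y])
    fix u assume u: "u \<in> effdom f"
    have "(x - y) \<bullet> (u - y) \<le> l * (real_of_ereal (f u) - \<beta>)"
      using var[OF mem_epi_real[OF u]] by (simp add: l_def)
    moreover have "(norm (x - u))\<^sup>2 = (norm (x - y))\<^sup>2 - 2 * ((x - y) \<bullet> (u - y)) + (norm (u - y))\<^sup>2"
      by (simp add: power2_norm_eq_inner inner_diff_left inner_diff_right inner_commute)
    ultimately have "2 * l * \<beta> + (norm (x - y))\<^sup>2 \<le> 2 * l * real_of_ereal (f u) + (norm (x - u))\<^sup>2"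
      using zero_le_power2[of "norm (u - y)"] unfolding right_diff_distrib mult.assoc by linarith
    moreover have "a + 1 / (2 * l) * b = (2 * l * a + b) / (2 * l)" for a b
      using l by (simp add: add_divide_distrib)
    ultimately show "real_of_ereal (f y) + 1 / (2 * l) * (norm (x - y))\<^sup>2
       \<le> real_of_ereal (f u) + 1 / (2 * l) * (norm (x - u))\<^sup>2"
      using l by (simp only: fyb divide_right_mono)
  qed
  then show thesis
    using that[OF l] yb Gamma0_real[OF y] fyb by (simp add: l_def)
qed

text \<open>
  With the minorant attached to the proximal point itself, the dual objective exceeds its
  value at \<open>l\<close> by at least half the squared distance of the parameters.
\<close>

lemma dual_objective_prox:
  assumes l: "0 < l" and eq: "f (prox f l x) = ereal (\<alpha> + l)"
  defines "y \<equiv> prox f l x"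
  shows "dual_objective f x \<alpha> l = ereal (- 1 / 2 * ((norm (x - y))\<^sup>2 + l\<^sup>2))"
    and "0 \<le> k \<Longrightarrow>
      ereal (- 1 / 2 * ((norm (x - y))\<^sup>2 + l\<^sup>2) + 1 / 2 * (k - l)\<^sup>2) \<le> dual_objective f x \<alpha> k"
proof -
  show "dual_objective f x \<alpha> l = ereal (- 1 / 2 * ((norm (x - y))\<^sup>2 + l\<^sup>2))"
    using phi_bar_pos[OF l, of x] eq
    by (simp add: dual_objective_def y_def power2_eq_square field_simps)
  assume "0 \<le> k"
  have "- k * (\<alpha> + l) - 1 / 2 * (norm (x - y))\<^sup>2 + \<alpha> * k + 1 / 2 * k\<^sup>2
      = - 1 / 2 * ((norm (x - y))\<^sup>2 + l\<^sup>2) + 1 / 2 * (k - l)\<^sup>2"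
    by (simp add: power2_eq_square algebra_simps add_divide_distrib diff_divide_distrib)
  with dual_objective_ge[OF \<open>0 \<le> k\<close> prox_in_effdom[OF l], of x x \<alpha>]
  show "ereal (- 1 / 2 * ((norm (x - y))\<^sup>2 + l\<^sup>2) + 1 / 2 * (k - l)\<^sup>2) \<le> dual_objective f x \<alpha> k"
    by (simp only: y_def eq real_of_ereal.simps)
qed

lemma is_arg_min_dual_objective_prox:
  assumes l: "0 < l" and eq: "f (prox f l x) = ereal (\<alpha> + l)"
  shows "is_arg_min (dual_objective f x \<alpha>) (\<lambda>l. 0 \<le> l) k \<longleftrightarrow> k = l"
proof -
  have lt: "dual_objective f x \<alpha> l < dual_objective f x \<alpha> j" if "0 \<le> j" "j \<noteq> l" for j
  proof -
    have "0 < (j - l)\<^sup>2" using that by simp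
    then show ?thesis
      using dual_objective_prox(2)[OF l eq that(1)] dual_objective_prox(1)[OF l eq]
      by (intro less_le_trans[OF _ dual_objective_prox(2)[OF l eq that(1)]]) simp
  qed
  show ?thesis
    using lt l unfolding is_arg_min_def by (metis less_asym less_irrefl less_imp_le)
qed

end

theorem corollary14:
  fixes f :: "'a::euclidean_space \<Rightarrow> ereal" and x :: 'a and \<alpha> :: real
  assumes "f \<in> Gamma0"
  shows
    "(\<exists>l. is_arg_min (dual_objective f x \<alpha>) (\<lambda>l. 0 \<le> l) l \<and>
          ereal (1 / 2 * (infdist (x, \<alpha>) (epi f))\<^sup>2) = - dual_objective f x \<alpha> l) \<and>
     (f (closest_point (closure (effdom f)) x) \<le> ereal \<alpha> \<longrightarrow>
        closest_point (epi f) (x, \<alpha>) = (closest_point (closure (effdom f)) x, \<alpha>)) \<and>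
     strongly_convex (dual_objective f x \<alpha>) \<and>
     strict_antimono_on {0<..} (\<lambda>l. f (prox f l x) - ereal l - ereal \<alpha>) \<and>
     (\<not> f (closest_point (closure (effdom f)) x) \<le> ereal \<alpha> \<longrightarrow>
        (\<exists>l>0. closest_point (epi f) (x, \<alpha>) = (prox f l x, \<alpha> + l) \<and>
           (\<forall>k. is_arg_min (dual_objective f x \<alpha>) (\<lambda>l. 0 \<le> l) k \<longleftrightarrow> k = l) \<and>
           (\<forall>k>0. f (prox f k x) - ereal k - ereal \<alpha> = 0 \<longleftrightarrow> k = l)))"
proof -
  note f = assms
  define p where "p = closest_point (closure (effdom f)) x"
  have A: "\<exists>l. is_arg_min (dual_objective f x \<alpha>) (\<lambda>l. 0 \<le> l) l \<and>
      ereal (1 / 2 * (infdist (x, \<alpha>) (epi f))\<^sup>2) = - dual_objective f x \<alpha> l"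
  proof (cases "f p \<le> ereal \<alpha>")
    case True
    then have p: "p \<in> effdom f" and fp: "real_of_ereal (f p) \<le> \<alpha>"
      using mem_epi_iff[OF f] by (auto simp: mem_epi[symmetric])
    have zero: "dual_objective f x \<alpha> 0 = ereal (- 1 / 2 * (norm (x - p))\<^sup>2)"
      by (simp add: dual_objective_def phi_bar_zero[OF f] p_def)
    have "dual_objective f x \<alpha> 0 \<le> dual_objective f x \<alpha> l" if "0 \<le> l" for l
    proof -
      have "l * real_of_ereal (f p) \<le> l * \<alpha>" using that fp by (intro mult_left_mono)
      then show ?thesis
        unfolding zero using zero_le_power2[of l]
        by (intro order_trans[OF _ dual_objective_ge[OF f that p, of x \<alpha>]])
          (simp add: mult.commute add_increasing2)
    qed
    moreover have "infdist (x, \<alpha>) (epi f) = norm (x - p)"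
      unfolding infdist_epi[OF f] closest_point_epi_proj[OF f p_def True]
      by (simp add: dist_Pair_Pair dist_norm)
    ultimately show ?thesis
      by (intro exI[of _ 0]) (auto simp: is_arg_min_linorder zero)
  next
    case False
    then obtain l where l: "0 < l" "closest_point (epi f) (x, \<alpha>) = (prox f l x, \<alpha> + l)"
      "f (prox f l x) = ereal (\<alpha> + l)"
      using closest_point_epi_prox[OF f] unfolding p_def by metis
    have "(infdist (x, \<alpha>) (epi f))\<^sup>2 = (norm (x - prox f l x))\<^sup>2 + l\<^sup>2"
      unfolding infdist_epi[OF f] l(2) dist_Pair_Pair by (simp add: dist_norm)
    then show ?thesis
      using is_arg_min_dual_objective_prox[OF f l(1,3)] dual_objective_prox(1)[OF f l(1,3)]
      by (intro exI[of _ l]) simp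
  qed
  have B: "\<exists>l>0. closest_point (epi f) (x, \<alpha>) = (prox f l x, \<alpha> + l) \<and>
           (\<forall>k. is_arg_min (dual_objective f x \<alpha>) (\<lambda>l. 0 \<le> l) k \<longleftrightarrow> k = l) \<and>
           (\<forall>k>0. f (prox f k x) - ereal k - ereal \<alpha> = 0 \<longleftrightarrow> k = l)"
    if gt: "\<not> f (closest_point (closure (effdom f)) x) \<le> ereal \<alpha>"
  proof -
    obtain l where l: "0 < l" "closest_point (epi f) (x, \<alpha>) = (prox f l x, \<alpha> + l)"
      "f (prox f l x) = ereal (\<alpha> + l)"
      using closest_point_epi_prox[OF f gt] by metis
    have root: "f (prox f l x) - ereal l - ereal \<alpha> = 0" by (simp add: l(3))
    have "k = l" if "0 < k" "f (prox f k x) - ereal k - ereal \<alpha> = 0" for k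
      using monotone_onD[OF strict_antimono_prox_residual[OF f, of x \<alpha>], of k l]
        monotone_onD[OF strict_antimono_prox_residual[OF f, of x \<alpha>], of l k] that l(1) root
      by (cases k l rule: linorder_cases) auto
    then show ?thesis
      using l root is_arg_min_dual_objective_prox[OF f l(1,3)] by blast
  qed
  show ?thesis
    using A B closest_point_epi_proj[OF f refl] strongly_convex_dual_objective[OF f]
      strict_antimono_prox_residual[OF f] by blast
qed

end
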